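(* $$\pi = 72\, S_1(1) - 96\, S_1(2) + 24\, S_1(4).$$
   Context: For a positive integer $n$ and real $r>0$, $S_n(r)=\sum_{k=1}^{\infty}\frac{1}{k^n(e^{\pi r k}-1)}$; in particular $S_1(r)=\sum_{k=1}^{\infty}\frac{1}{k(e^{\pi r k}-1)}$. *)

theory Defs
  imports "HOL-Analysis.Analysis"
begin

(* Used only for n > 0 and r > 0. The index k >= 1 of the series is written Suc k. *)
definition S :: "nat \<Rightarrow> real \<Rightarrow> real" where
  "S n r = (\<Sum>k. 1 / (real (Suc k) ^ n * (exp (pi * r * real (Suc k)) - 1)))"

(* For r > 0 the series converges, so suminf is its genuine sum. *)
lemma summable_S:
  fixes r :: real
  assumes "r > 0"
  shows "summable (\<lambda>k. 1 / (real (Suc k) ^ n * (exp (pi * r * real (Suc k)) - 1)))"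
proof -
  define a where "a = pi * r"
  have a: "a > 0" using assms by (simp add: a_def)
  have "summable (\<lambda>k. exp (- a) ^ k * (1 / (exp a - 1)))"
    using a by (intro summable_mult2 summable_geometric) simp
  then show ?thesis
  proof (rule summable_comparison_test', unfold a_def[symmetric])
    fix k :: nat
    have e: "exp (a * real (Suc k)) = exp a * exp (a * real k)"
      by (simp add: algebra_simps flip: exp_add)
    have g: "exp (a * real k) \<ge> 1" using a by simp
    have p: "(exp a - 1) * exp (a * real k) > 0" using a by simp
    have le: "(exp a - 1) * exp (a * real k) \<le> exp (a * real (Suc k)) - 1"
      using g unfolding e by (simp add: algebra_simps)
    have "1 * (exp (a * real (Suc k)) - 1) \<le> real (Suc k) ^ n * (exp (a * real (Suc k)) - 1)"
      using a by (intro mult_right_mono one_le_power) auto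
    then have le2: "(exp a - 1) * exp (a * real k)
        \<le> real (Suc k) ^ n * (exp (a * real (Suc k)) - 1)"
      using le unfolding mult_1 by (rule order_trans[rotated])
    then have "norm (1 / (real (Suc k) ^ n * (exp (a * real (Suc k)) - 1)))
        = 1 / (real (Suc k) ^ n * (exp (a * real (Suc k)) - 1))"
      using p by simp
    also have "\<dots> \<le> 1 / ((exp a - 1) * exp (a * real k))"
      using le2 p by (intro divide_left_mono mult_pos_pos[OF order_less_le_trans[OF p le2] p]) simp_all
    also have "\<dots> = exp (- a) ^ k * (1 / (exp a - 1))"
      by (simp add: exp_minus power_inverse field_simps flip: exp_of_nat_mult)
    finally show "norm (1 / (real (Suc k) ^ n * (exp (a * real (Suc k)) - 1)))
        \<le> exp (- a) ^ k * (1 / (exp a - 1))" .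
  qed
qed

end

theory Submission
  imports Defs "HOL-Probability.Distributions"
begin

text \<open>Summing over one index shows that \<open>exp (- S 1 r)\<close> is Euler's product
  \<open>\<Prod>(1 - q\<^sup>k)\<close> at \<open>q = exp (- pi r)\<close>. By Jacobi's triple product the theta constants
  \<open>\<Sum>(-1)\<^sup>n q\<^bsup>n\<^sup>2\<^esup>\<close> and \<open>\<Sum>q\<^bsup>(n + 1/2)\<^sup>2\<^esup>\<close> are quotients of such products. Two relations
  between theta constants at \<open>q = exp (- pi)\<close> then give two linear relations between \<open>S 1 1\<close>,
  \<open>S 1 2\<close>, \<open>S 1 4\<close>, \<open>pi\<close> and \<open>ln 2\<close>, from which \<open>ln 2\<close> is eliminated. The first
  relation, the equality of these two theta constants, is the modular transformation at the fixed
  point \<open>t = 1\<close>; instead of Poisson summation the proof uses that the duplication formulas are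
  steps of the arithmetic-geometric mean, both for \<open>t \<rightarrow> \<infinity>\<close> and for \<open>t \<rightarrow> 0\<close>. The second is
  Jacobi's quartic identity combined with duplication.\<close>

subsection \<open>Absolutely convergent sums\<close>

lemma has_sum_product_real:
  fixes f :: "'a \<Rightarrow> real" and g :: "'b \<Rightarrow> real"
  assumes f: "(f has_sum x) A" and g: "(g has_sum y) B"
  shows "((\<lambda>(a, b). f a * g b) has_sum x * y) (A \<times> B)"
proof -
  have sf: "(\<lambda>a. norm (f a)) summable_on A" and sg: "(\<lambda>b. norm (g b)) summable_on B"
    using f g has_sum_imp_summable summable_on_iff_abs_summable_on_real by blast+
  have "(\<lambda>p. norm (case p of (a, b) \<Rightarrow> f a * g b)) summable_on Sigma A (\<lambda>_. B)"
    by (subst Infinite_Sum.abs_summable_on_Sigma_iff)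
       (auto simp: norm_mult abs_mult infsum_cmult_right' sf[simplified] sg[simplified] infsum_nonneg
             intro!: summable_on_cmult_right summable_on_cmult_left)
  then have "(\<lambda>(a, b). f a * g b) summable_on A \<times> B"
    by (rule abs_summable_summable)
  moreover have "((\<lambda>a. f a * y) has_sum x * y) A"
    by (rule has_sum_cmult_left[OF f])
  ultimately show ?thesis
    by (intro has_sum_SigmaI[where g = "\<lambda>a. f a * y"]) (auto intro!: has_sum_cmult_right g)
qed

text \<open>Dominated convergence for the counting measure: below a summable bound,
  \<open>infsum\<close> agrees with the Lebesgue integral over \<open>count_space A\<close>.\<close>

lemma tendsto_infsum_dominated:
  fixes f :: "nat \<Rightarrow> 'a \<Rightarrow> real"
  assumes g: "g summable_on A"
    and le: "\<And>n x. x \<in> A \<Longrightarrow> \<bar>f n x\<bar> \<le> g x"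
    and lim: "\<And>x. x \<in> A \<Longrightarrow> (\<lambda>n. f n x) \<longlonglongrightarrow> h x"
  shows "(\<lambda>n. infsum (f n) A) \<longlonglongrightarrow> infsum h A"
proof -
  have "Infinite_Set_Sum.abs_summable_on g A"
    using g abs_summable_equivalent[of g A] summable_on_iff_abs_summable_on_real[of g A] by simp
  then have int_g: "integrable (count_space A) g"
    by (simp only: abs_summable_on_def)
  have hle: "\<bar>h x\<bar> \<le> g x" if "x \<in> A" for x
    by (rule LIMSEQ_le_const2[OF tendsto_rabs[OF lim[OF that]]]) (auto intro: le that)
  have conv: "integral\<^sup>L (count_space A) u = infsum u A" if "\<And>x. x \<in> A \<Longrightarrow> \<bar>u x\<bar> \<le> g x" for u
  proof -
    have "Infinite_Set_Sum.abs_summable_on u A"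
      unfolding abs_summable_on_def
      by (rule Bochner_Integration.integrable_bound[OF int_g]) (simp_all add: AE_count_space order_trans[OF that abs_ge_self])
    then show ?thesis
      using infsetsum_infsum[of u A] by (simp only: infsetsum_def)
  qed
  have "(\<lambda>n. integral\<^sup>L (count_space A) (f n)) \<longlonglongrightarrow> integral\<^sup>L (count_space A) h"
    by (rule integral_dominated_convergence[OF _ _ int_g]) (simp_all add: AE_count_space lim le)
  moreover have "integral\<^sup>L (count_space A) (f n) = infsum (f n) A" for n
    by (intro conv le)
  ultimately show ?thesis
    by (simp only: conv[OF hle])
qed

text \<open>The maps \<open>(a, b) \<mapsto> (a + b, a - b)\<close> and
  \<open>(a, b) \<mapsto> (a + b + 1, a - b)\<close> are bijections from the integer pairs onto the
  pairs with even sum and with odd sum.\<close>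

lemma has_sum_int_pairs:
  fixes F :: "int \<times> int \<Rightarrow> real"
  assumes "((\<lambda>(a, b). F (a + b, a - b)) has_sum x) UNIV"
    and "((\<lambda>(a, b). F (a + b + 1, a - b)) has_sum y) UNIV"
  shows "(F has_sum x + y) UNIV"
proof -
  define E where "E = {(m, n). even (m + n :: int)}"
  have halve': "(m + n) div 2 + (m - n) div 2 = m" "(m + n) div 2 - (m - n) div 2 = n"
    if "even (m + n)" for m n :: int
    using that by presburger+
  have halve: "(m + n) div 2 + (m - n) div 2 + 1 = m" "(m + n) div 2 - (m - n) div 2 = n"
    if "odd (m + n)" for m n :: int
    using that by presburger+
  have "(F has_sum x) E = ((\<lambda>(a, b). F (a + b, a - b)) has_sum x) UNIV"
    by (rule has_sum_reindex_bij_witness[where i = "\<lambda>(a, b). (a + b, a - b)"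
          and j = "\<lambda>(m, n). ((m + n) div 2, (m - n) div 2)"]) (auto simp: E_def halve')
  moreover have "(F has_sum y) (- E) = ((\<lambda>(a, b). F (a + b + 1, a - b)) has_sum y) UNIV"
    by (rule has_sum_reindex_bij_witness[where i = "\<lambda>(a, b). (a + b + 1, a - b)"
          and j = "\<lambda>(m, n). ((m + n) div 2, (m - n) div 2)"])
       (auto simp: E_def simp del: even_add intro!: halve arg_cong[where f = F])
  ultimately have "(F has_sum x + y) (E \<union> - E)"
    using assms by (intro has_sum_Un_disjoint) auto
  then show ?thesis by (simp add: Compl_partition)
qed

lemma summable_on_int:
  fixes f :: "int \<Rightarrow> real"
  assumes "\<And>n. f n \<ge> 0" "summable (\<lambda>n. f (int n))" "summable (\<lambda>n. f (- int n))"
  shows "f summable_on UNIV"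
proof -
  have "f summable_on range int"
    by (subst summable_on_reindex) (simp_all add: o_def summable_on_UNIV_nonneg_real_iff assms)
  moreover have "f summable_on range (\<lambda>n. - int n)"
    by (subst summable_on_reindex) (simp_all add: o_def summable_on_UNIV_nonneg_real_iff assms inj_def)
  ultimately have "f summable_on (range int \<union> range (\<lambda>n. - int n))"
    by (rule summable_on_union)
  moreover have "UNIV = range int \<union> range (\<lambda>n. - int n)"
  proof (intro UNIV_eq_I)
    fix n :: int
    show "n \<in> range int \<union> range (\<lambda>n. - int n)"
      by (cases n rule: int_cases2) auto
  qed
  ultimately show ?thesis by simp
qed

subsection \<open>Theta constants\<close>

text \<open>In Jacobi's notation with nome \<open>exp (- (pi * t))\<close>, \<open>theta 0 t\<close>
  is theta_3, \<open>theta (1/2) t\<close> is theta_2 and \<open>theta_alt t\<close> is theta_4. The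
  shift \<open>a\<close> lets one convergence proof serve the first two.\<close>

definition theta :: "real \<Rightarrow> real \<Rightarrow> real" where
  "theta a t = (\<Sum>\<^sub>\<infinity>n::int. exp (- (pi * t * (of_int n + a)\<^sup>2)))"

definition theta_alt :: "real \<Rightarrow> real" where
  "theta_alt t = (\<Sum>\<^sub>\<infinity>n::int. (if even n then 1 else - 1) * exp (- (pi * t * (of_int n)\<^sup>2)))"

lemma summable_gauss:
  assumes "t > 0"
  shows "(\<lambda>n::int. exp (- (pi * t * (of_int n + a)\<^sup>2))) summable_on UNIV"
proof -
  define c where "c = pi * t"
  have c: "c > 0" using assms by (simp add: c_def)
  define K where "K = exp (1 / (4 * c) + \<bar>a\<bar>)"
  have bound: "exp (- (c * (x + a)\<^sup>2)) \<le> K * exp (- 1) ^ n" if "\<bar>x\<bar> = real n" for x n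
  proof -
    define y where "y = \<bar>x + a\<bar>"
    \<comment> \<open>Completing the square bounds the Gaussian exponent by a linear one, so a
      geometric series dominates on both half-lines; \<open>K\<close> collects the
      constants.\<close>
    have "0 \<le> (2 * c * y - 1)\<^sup>2 / (4 * c)" using c by simp
    also have "\<dots> = c * y\<^sup>2 - y + 1 / (4 * c)"
      using c by (simp add: power2_eq_square field_simps)
    finally have "- (c * y\<^sup>2) \<le> 1 / (4 * c) - y" by linarith
    also have "\<dots> \<le> 1 / (4 * c) + \<bar>a\<bar> - real n"
      using that by (simp add: y_def)
    finally have "exp (- (c * y\<^sup>2)) \<le> exp (1 / (4 * c) + \<bar>a\<bar> - real n)" by simp
    also have "\<dots> = K * exp (- 1) ^ n"
      by (simp add: K_def flip: exp_add exp_of_nat_mult)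
    finally show ?thesis by (simp add: y_def)
  qed
  have "summable (\<lambda>n. K * exp (- 1 :: real) ^ n)"
    by (intro summable_mult summable_geometric) simp
  then have "summable (\<lambda>n. exp (- (c * (of_int (g n) + a)\<^sup>2)))" if "\<And>n. \<bar>g n\<bar> = int n" for g
  proof (rule summable_comparison_test')
    fix n
    have "\<bar>real_of_int (g n)\<bar> = real n" using that[of n] by linarith
    then show "norm (exp (- (c * (of_int (g n) + a)\<^sup>2))) \<le> K * exp (- 1) ^ n"
      using bound by simp
  qed
  from this[of int] this[of "\<lambda>n. - int n"] show ?thesis
    by (intro summable_on_int) (simp_all add: c_def)
qed

lemma has_sum_theta:
  assumes "t > 0"
  shows "((\<lambda>n::int. exp (- (pi * t * (of_int n + a)\<^sup>2))) has_sum theta a t) UNIV"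
  unfolding theta_def using summable_gauss[OF assms] by (rule has_sum_infsum)

lemma has_sum_theta_alt:
  assumes "t > 0"
  shows "((\<lambda>n::int. (if even n then 1 else - 1) * exp (- (pi * t * (of_int n)\<^sup>2)))
    has_sum theta_alt t) UNIV"
  unfolding theta_alt_def
proof (rule has_sum_infsum, rule abs_summable_summable)
  have "(\<lambda>n::int. norm ((if even n then 1 else - 1) * exp (- (pi * t * (of_int n)\<^sup>2)))) =
    (\<lambda>n::int. exp (- (pi * t * (of_int n + 0)\<^sup>2)))"
    by (auto simp: norm_mult)
  then show "(\<lambda>n::int. norm ((if even n then 1 else - 1) * exp (- (pi * t * (of_int n)\<^sup>2))))
      summable_on UNIV"
    using summable_gauss[OF assms, of 0] by (simp only:)
qed

lemma theta_pos:
  assumes "t > 0"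
  shows "theta a t > 0"
proof -
  have "exp (- (pi * t * a\<^sup>2)) \<le> theta a t"
    using finite_sum_le_has_sum[OF has_sum_theta[OF assms], of "{0}"] by simp
  then show ?thesis using exp_gt_zero order_less_le_trans by blast
qed

lemma theta_one: "theta 1 t = theta 0 t"
  unfolding theta_def
  by (rule infsum_reindex_bij_witness[where i = "\<lambda>n. n - 1" and j = "\<lambda>n. n + 1"]) auto

text \<open>In the next three lemmas the double series over \<open>(m, n)\<close> is split by the parity of \<open>m + n\<close>
  and the forms \<open>m\<^sup>2 + n\<^sup>2\<close> are diagonalised by \<open>(m, n) = (a + b, a - b)\<close>.\<close>

lemma theta_zero_square:
  assumes t: "t > 0"
  shows "(theta 0 t)\<^sup>2 = (theta 0 (2 * t))\<^sup>2 + (theta (1/2) (2 * t))\<^sup>2"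
proof -
  define F where "F = (\<lambda>(m, n). exp (- (pi * t * (of_int m + 0)\<^sup>2)) * exp (- (pi * t * (of_int n + 0)\<^sup>2)))"
  have t2: "2 * t > 0" using t by simp
  have "(F has_sum theta 0 t * theta 0 t) UNIV"
    using has_sum_product_real[OF has_sum_theta[OF t, of "0"] has_sum_theta[OF t, of "0"]]
    by (simp add: F_def)
  moreover have "(F has_sum theta 0 (2 * t) * theta 0 (2 * t)
      + theta (1/2) (2 * t) * theta (1/2) (2 * t)) UNIV"
  proof (rule has_sum_int_pairs)
    have "F (a + b, a - b) = exp (- (pi * (2 * t) * (of_int a + 0)\<^sup>2))
        * exp (- (pi * (2 * t) * (of_int b + 0)\<^sup>2))" for a b
      by (simp add: F_def power2_eq_square algebra_simps flip: exp_add)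
    then show "((\<lambda>(a, b). F (a + b, a - b)) has_sum theta 0 (2 * t) * theta 0 (2 * t)) UNIV"
      using has_sum_product_real[OF has_sum_theta[OF t2, of "0"] has_sum_theta[OF t2, of "0"]] by simp
    have "F (a + b + 1, a - b) = exp (- (pi * (2 * t) * (of_int a + 1/2)\<^sup>2))
        * exp (- (pi * (2 * t) * (of_int b + 1/2)\<^sup>2))" for a b
      by (simp add: F_def power2_eq_square algebra_simps flip: exp_add)
    then show "((\<lambda>(a, b). F (a + b + 1, a - b)) has_sum theta (1/2) (2 * t) * theta (1/2) (2 * t)) UNIV"
      using has_sum_product_real[OF has_sum_theta[OF t2, of "1/2"] has_sum_theta[OF t2, of "1/2"]] by simp
  qed
  ultimately have "theta 0 t * theta 0 t = theta 0 (2 * t) * theta 0 (2 * t)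
      + theta (1/2) (2 * t) * theta (1/2) (2 * t)"
    by (rule has_sum_unique)
  then show ?thesis by (simp add: power2_eq_square)
qed

lemma theta_alt_square:
  assumes t: "t > 0"
  shows "(theta_alt t)\<^sup>2 = (theta 0 (2 * t))\<^sup>2 - (theta (1/2) (2 * t))\<^sup>2"
proof -
  define F where "F = (\<lambda>(m::int, n::int). ((if even m then 1 else - 1) * exp (- (pi * t * (of_int m)\<^sup>2)))
     * ((if even n then 1 else - 1) * exp (- (pi * t * (of_int n)\<^sup>2))))"
  have t2: "2 * t > 0" using t by simp
  have "(F has_sum theta_alt t * theta_alt t) UNIV"
    using has_sum_product_real[OF has_sum_theta_alt[OF t] has_sum_theta_alt[OF t]] by (simp add: F_def)
  moreover have "(F has_sum theta 0 (2 * t) * theta 0 (2 * t) + - (theta (1/2) (2 * t) * theta (1/2) (2 * t))) UNIV"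
  proof (rule has_sum_int_pairs)
    have "F (a + b, a - b) = exp (- (pi * (2 * t) * (of_int a + 0)\<^sup>2)) * exp (- (pi * (2 * t) * (of_int b + 0)\<^sup>2))" for a b
      by (auto simp: F_def power2_eq_square algebra_simps simp flip: exp_add)
    then show "((\<lambda>(a, b). F (a + b, a - b)) has_sum theta 0 (2 * t) * theta 0 (2 * t)) UNIV"
      using has_sum_product_real[OF has_sum_theta[OF t2, of 0] has_sum_theta[OF t2, of 0]] by simp
    have "F (a + b + 1, a - b) = - (exp (- (pi * (2 * t) * (of_int a + 1/2)\<^sup>2)) * exp (- (pi * (2 * t) * (of_int b + 1/2)\<^sup>2)))" for a b
      by (auto simp: F_def power2_eq_square algebra_simps simp flip: exp_add)
    then show "((\<lambda>(a, b). F (a + b + 1, a - b)) has_sum - (theta (1/2) (2 * t) * theta (1/2) (2 * t))) UNIV"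
      using has_sum_uminusI[OF has_sum_product_real[OF has_sum_theta[OF t2, of "1/2"] has_sum_theta[OF t2, of "1/2"]]]
      by (simp add: case_prod_unfold)
  qed
  ultimately show ?thesis
    using has_sum_unique by (fastforce simp: power2_eq_square)
qed

lemma theta_half_square:
  assumes t: "t > 0"
  shows "(theta (1/2) t)\<^sup>2 = 2 * theta (1/2) (2 * t) * theta 0 (2 * t)"
proof -
  define F where "F = (\<lambda>(m, n). exp (- (pi * t * (of_int m + 1/2)\<^sup>2)) * exp (- (pi * t * (of_int n + 1/2)\<^sup>2)))"
  have t2: "2 * t > 0" using t by simp
  have "(F has_sum theta (1/2) t * theta (1/2) t) UNIV"
    using has_sum_product_real[OF has_sum_theta[OF t, of "1/2"] has_sum_theta[OF t, of "1/2"]]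
    by (simp add: F_def)
  moreover have "(F has_sum theta (1/2) (2 * t) * theta 0 (2 * t)
      + theta 1 (2 * t) * theta (1/2) (2 * t)) UNIV"
  proof (rule has_sum_int_pairs)
    have "F (a + b, a - b) = exp (- (pi * (2 * t) * (of_int a + 1/2)\<^sup>2))
        * exp (- (pi * (2 * t) * (of_int b + 0)\<^sup>2))" for a b
      by (simp add: F_def power2_eq_square algebra_simps flip: exp_add)
    then show "((\<lambda>(a, b). F (a + b, a - b)) has_sum theta (1/2) (2 * t) * theta 0 (2 * t)) UNIV"
      using has_sum_product_real[OF has_sum_theta[OF t2, of "1/2"] has_sum_theta[OF t2, of "0"]] by simp
    have "F (a + b + 1, a - b) = exp (- (pi * (2 * t) * (of_int a + 1)\<^sup>2))
        * exp (- (pi * (2 * t) * (of_int b + 1/2)\<^sup>2))" for a b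
      by (simp add: F_def power2_eq_square algebra_simps flip: exp_add)
    then show "((\<lambda>(a, b). F (a + b + 1, a - b)) has_sum theta 1 (2 * t) * theta (1/2) (2 * t)) UNIV"
      using has_sum_product_real[OF has_sum_theta[OF t2, of "1"] has_sum_theta[OF t2, of "1/2"]] by simp
  qed
  ultimately have "theta (1/2) t * theta (1/2) t = theta (1/2) (2 * t) * theta 0 (2 * t)
      + theta 1 (2 * t) * theta (1/2) (2 * t)"
    by (rule has_sum_unique)
  then show ?thesis by (simp add: power2_eq_square theta_one)
qed

text \<open>With \<open>X = theta 0 (2 * t)\<close> and \<open>Y = theta (1/2) (2 * t)\<close> the
  duplication formulas reduce this to \<open>(X\<^sup>2 + Y\<^sup>2)\<^sup>2 = (X\<^sup>2 -
  Y\<^sup>2)\<^sup>2 + (2 * X * Y)\<^sup>2\<close>.\<close>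

lemma jacobi_quartic:
  assumes "t > 0"
  shows "theta 0 t ^ 4 = theta_alt t ^ 4 + theta (1/2) t ^ 4"
proof -
  have p4: "x ^ 4 = (x\<^sup>2)\<^sup>2" for x :: real by simp
  show ?thesis
    unfolding p4 theta_zero_square[OF assms] theta_alt_square[OF assms] theta_half_square[OF assms]
    by (simp add: power2_eq_square algebra_simps)
qed

text \<open>The quartic identity at \<open>2 * t\<close> gives a difference of fourth powers; its
  factors, the sum and the difference of squares, are the duplication formulas at \<open>t\<close>.
  This is the geometric-mean half of an AGM step.\<close>

lemma theta_alt_double:
  assumes "t > 0"
  shows "theta_alt (2 * t) ^ 4 = (theta 0 t)\<^sup>2 * (theta_alt t)\<^sup>2"
  using jacobi_quartic[of "2 * t"] assms
  unfolding theta_zero_square[OF assms] theta_alt_square[OF assms]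
  by (simp add: algebra_simps power2_eq_square power4_eq_xxxx)

text \<open>Only the term of index 0 survives, and the series at \<open>t = 1\<close> dominates
  because \<open>T n \<ge> 1\<close>.\<close>

lemma tendsto_thetas_at_top:
  assumes "\<And>n. T n \<ge> 1" and "filterlim T at_top sequentially"
  shows "(\<lambda>n. theta 0 (T n)) \<longlonglongrightarrow> 1" "(\<lambda>n. theta_alt (T n)) \<longlonglongrightarrow> 1"
proof -
  define h :: "int \<Rightarrow> real" where "h = (\<lambda>k. if k = 0 then 1 else 0)"
  have h: "infsum h UNIV = 1"
    by (rule infsumI, rule has_sum_finite_neutralI[of "{0}"]) (auto simp: h_def)
  have le: "exp (- (pi * T n * (of_int k)\<^sup>2)) \<le> exp (- (pi * 1 * (of_int k + 0)\<^sup>2))" for n and k :: int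
    using mult_right_mono[OF assms(1)[of n], of "(of_int k)\<^sup>2"] by simp
  have lim: "(\<lambda>n. exp (- (pi * T n * (of_int k)\<^sup>2))) \<longlonglongrightarrow> h k" for k
  proof (cases "k = 0")
    case False
    then have "filterlim (\<lambda>n. (pi * (of_int k)\<^sup>2) * T n) at_top sequentially"
      by (intro filterlim_tendsto_pos_mult_at_top[OF tendsto_const _ assms(2)]) auto
    then have "filterlim (\<lambda>n. - ((pi * (of_int k)\<^sup>2) * T n)) at_bot sequentially"
      by (simp add: filterlim_uminus_at_top)
    then have "(\<lambda>n. exp (- ((pi * (of_int k)\<^sup>2) * T n))) \<longlonglongrightarrow> 0"
      by (rule filterlim_compose[OF exp_at_bot])
    then show ?thesis using False by (simp add: h_def mult_ac)
  qed (simp add: h_def)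
  have "(\<lambda>n. theta 0 (T n)) \<longlonglongrightarrow> infsum h UNIV"
    unfolding theta_def using le lim
    by (intro tendsto_infsum_dominated[OF summable_gauss[of 1 0]]) auto
  then show "(\<lambda>n. theta 0 (T n)) \<longlonglongrightarrow> 1" by (simp add: h)
  have lim': "(\<lambda>n. (if even k then 1 else - 1) * exp (- (pi * T n * (of_int k)\<^sup>2))) \<longlonglongrightarrow> h k" for k
    using tendsto_mult_left[OF lim, of "if even k then 1 else - 1" k]
    by (cases "k = 0") (auto simp: h_def)
  have "(\<lambda>n. theta_alt (T n)) \<longlonglongrightarrow> infsum h UNIV"
    unfolding theta_alt_def using le
    by (intro tendsto_infsum_dominated[OF summable_gauss[of 1 0]] lim') (simp_all add: abs_mult)
  then show "(\<lambda>n. theta_alt (T n)) \<longlonglongrightarrow> 1" by (simp add: h)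
qed

subsection \<open>The value of the arithmetic-geometric mean determines the starting values\<close>

text \<open>The AGM step is monotone and homogeneous. If \<open>b 0\<close> exceeded
  \<open>b' 0\<close>, one step would make both components larger by some factor
  \<open>r > 1\<close>; this factor would persist and contradict the common limit 1.\<close>

lemma agm_le:
  fixes a b a' b' :: "nat \<Rightarrow> real"
  assumes a: "\<And>n. a (Suc n) = (a n + b n) / 2" and b: "\<And>n. (b (Suc n))\<^sup>2 = a n * b n"
    and a': "\<And>n. a' (Suc n) = (a' n + b' n) / 2" and b': "\<And>n. (b' (Suc n))\<^sup>2 = a' n * b' n"
    and pos: "\<And>n. a' n > 0" "\<And>n. b n \<ge> 0" "\<And>n. b' n \<ge> 0"
    and lim: "a \<longlonglongrightarrow> 1" "a' \<longlonglongrightarrow> 1" and init: "a 0 = a' 0"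
  shows "b 0 \<le> b' 0"
proof (rule ccontr)
  assume "\<not> b 0 \<le> b' 0"
  then have less: "b' 0 < b 0" by simp
  have pos': "a n > 0" for n
    by (induction n) (use init pos in \<open>simp_all add: a add_pos_nonneg\<close>)
  have ratio: "\<exists>r>1. r * u' \<le> u" if "0 \<le> u'" "u' < u" for u u' :: real
  proof (cases "u' = 0")
    case False
    then show ?thesis using that by (intro exI[of _ "u / u'"]) auto
  qed (use that in \<open>auto intro: exI[of _ 2]\<close>)
  \<comment> \<open>At index 0 the first components agree, so a uniform factor above 1 exists only
    from index 1 on.\<close>
  have "a' 1 < a 1" using less init a[of 0] a'[of 0] by simp
  moreover have "b' 1 < b 1"
  proof (rule power2_less_imp_less)
    show "(b' 1)\<^sup>2 < (b 1)\<^sup>2"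
      using less init b[of 0] b'[of 0] pos(1)[of 0] by simp
  qed (rule pos)
  ultimately obtain r1 r2 where r: "r1 > 1" "r1 * a' 1 \<le> a 1" "r2 > 1" "r2 * b' 1 \<le> b 1"
    using ratio pos by (metis less_imp_le)
  define r where "r = min r1 r2"
  have r1: "r > 1" using r by (simp add: r_def)
  have "r * a' (Suc n) \<le> a (Suc n) \<and> r * b' (Suc n) \<le> b (Suc n)" for n
  proof (induction n)
    case 0
    have "r * a' 1 \<le> r1 * a' 1" "r * b' 1 \<le> r2 * b' 1"
      by (intro mult_right_mono less_imp_le[OF pos(1)] pos(3); simp add: r_def)+
    then show ?case using r by simp
  next
    case (Suc n)
    have "(r * b' (Suc (Suc n)))\<^sup>2 = (r * a' (Suc n)) * (r * b' (Suc n))"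
      using b'[of "Suc n"] by (simp add: power_mult_distrib power2_eq_square)
    also have "\<dots> \<le> a (Suc n) * b (Suc n)"
      using Suc pos' pos r1 by (intro mult_mono) (auto intro: less_imp_le)
    also have "\<dots> = (b (Suc (Suc n)))\<^sup>2" using b by simp
    finally have "r * b' (Suc (Suc n)) \<le> b (Suc (Suc n))"
      by (rule power2_le_imp_le) (rule pos)
    moreover have "r * a' (Suc (Suc n)) = (r * a' (Suc n) + r * b' (Suc n)) / 2"
      by (simp add: a' distrib_left)
    ultimately show ?case using Suc a[of "Suc n"] by simp
  qed
  then have "r * 1 \<le> 1"
    by (intro LIMSEQ_le[OF tendsto_mult_left[OF LIMSEQ_Suc[OF lim(2)], of r] LIMSEQ_Suc[OF lim(1)]]) auto
  then show False using r1 by simp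
qed

subsection \<open>The behaviour of theta at the cusp zero\<close>

text \<open>Twice the sum over the nonnegative integers counts the term at 0 once too often.\<close>

lemma has_sum_even_int:
  fixes f :: "int \<Rightarrow> real"
  assumes "\<And>n. f n \<ge> 0" and "\<And>n. f (- n) = f n" and s: "(\<lambda>n. f (int n)) sums s"
  shows "(f has_sum (2 * s - f 0)) UNIV"
proof -
  have "(\<lambda>n. f (int (Suc n))) sums (s - f 0)"
    using s sums_Suc_iff[of "\<lambda>n. f (int n)" "s - f 0"] by simp
  then have "((\<lambda>n. f (int (Suc n))) has_sum (s - f 0)) UNIV"
    by (rule sums_nonneg_imp_has_sum) (rule assms)
  also have "?this \<longleftrightarrow> (f has_sum (s - f 0)) {..<0}"
    by (rule has_sum_reindex_bij_witness[where i = "\<lambda>n. nat (- n - 1)" and j = "\<lambda>n. - int (Suc n)"])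
       (auto simp: assms(2) simp del: of_nat_Suc)
  finally have neg: "(f has_sum (s - f 0)) {..<0}" .
  have "((\<lambda>n. f (int n)) has_sum s) UNIV"
    by (rule sums_nonneg_imp_has_sum[OF s]) (rule assms)
  also have "?this \<longleftrightarrow> (f has_sum s) {0..}"
    by (rule has_sum_reindex_bij_witness[where i = nat and j = int]) auto
  finally have "(f has_sum ((s - f 0) + s)) ({..<0} \<union> {0..})"
    by (intro has_sum_Un_disjoint neg) auto
  moreover have "{..<0} \<union> {0..} = (UNIV :: int set)" by auto
  ultimately show ?thesis by (simp add: algebra_simps)
qed

lemma half_gauss_integral_limit:
  assumes t: "t > 0"
  shows "(\<lambda>n. integral {0..real n} (\<lambda>x. exp (- (pi * t * x\<^sup>2)))) \<longlonglongrightarrow> 1 / (2 * sqrt t)"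
proof -
  define c where "c = sqrt (pi * t)"
  have c: "c > 0" "c\<^sup>2 = pi * t" using t by (simp_all add: c_def)
  define f where "f = (\<lambda>x. exp (- (pi * t * x\<^sup>2)))"
  \<comment> \<open>The standard half-line Gaussian integral \<open>sqrt pi / 2\<close> is rescaled
    by \<open>x \<mapsto> c * x\<close>.\<close>
  have "has_bochner_integral lborel (\<lambda>x. indicator {0..} (0 + c * x) *\<^sub>R exp (- (0 + c * x)\<^sup>2))
      ((sqrt pi / 2) /\<^sub>R \<bar>c\<bar>)"
    using gaussian_moment_0 c(1) by (subst (asm) lborel_has_bochner_integral_real_affine_iff[of c _ _ 0]) simp_all
  moreover have "(sqrt pi / 2) /\<^sub>R \<bar>c\<bar> = 1 / (2 * sqrt t)"
    using t by (simp add: c_def real_sqrt_mult field_simps)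
  moreover have "indicator {0..} (0 + c * x) *\<^sub>R exp (- (0 + c * x)\<^sup>2) = indicator {0..} x *\<^sub>R f x" for x
    using c by (auto simp: f_def power_mult_distrib indicator_def zero_le_mult_iff)
  ultimately have int: "has_bochner_integral lborel (\<lambda>x. indicator {0..} x *\<^sub>R f x) (1 / (2 * sqrt t))"
    by (simp only:)
  have "((\<lambda>y. \<integral>x. indicator {..y} x *\<^sub>R (indicator {0..} x *\<^sub>R f x) \<partial>lborel)
      \<longlongrightarrow> 1 / (2 * sqrt t)) at_top"
    using tendsto_integral_at_top[of lborel, OF _ integrable.intros[OF int]] int
    by (simp add: has_bochner_integral_integral_eq)
  moreover have "(\<integral>x. indicator {..y} x *\<^sub>R (indicator {0..} x *\<^sub>R f x) \<partial>lborel) = integral {0..y} f" for y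
  proof -
    have "(\<integral>x. indicator {..y} x *\<^sub>R (indicator {0..} x *\<^sub>R f x) \<partial>lborel) = (LINT x:{0..y}|lborel. f x)"
      unfolding set_lebesgue_integral_def
      by (rule Bochner_Integration.integral_cong) (auto simp: indicator_def)
    moreover have "set_integrable lborel {0..y} f"
      unfolding set_integrable_def f_def
      by (rule borel_integrable_compact) (auto intro!: continuous_intros)
    then have "(LINT x:{0..y}|lborel. f x) = integral {0..y} f"
      by (rule set_borel_integral_eq_integral)
    ultimately show ?thesis by simp
  qed
  ultimately have "((\<lambda>y. integral {0..y} f) \<longlongrightarrow> 1 / (2 * sqrt t)) at_top" by simp
  from filterlim_compose[OF this filterlim_real_sequentially] show ?thesis
    by (simp only: f_def)
qed

text \<open>For a decreasing \<open>f\<close>, the sum over the nonnegative integers exceeds the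
  integral by an amount between 0 and \<open>f 0 = 1\<close>. Doubling and removing the repeated
  central term leaves an error between -1 and 1.\<close>

lemma theta_zero_bounds:
  assumes t: "t > 0"
  shows "\<bar>theta 0 t - 1 / sqrt t\<bar> \<le> 1"
proof -
  define f where "f = (\<lambda>x. exp (- (pi * t * x\<^sup>2)))"
  interpret antimono_fun_sum_integral_diff f
  proof
    show "f y \<le> f x" if "0 \<le> x" "x \<le> y" for x y
      using power_mono[OF that(2,1), of 2] t by (simp add: f_def)
  qed (simp_all add: f_def continuous_intros)
  note lim = half_gauss_integral_limit[OF t, folded f_def]
  have "summable (\<lambda>n. f (real n))"
    using lim integral_test by (auto simp: convergent_def)
  then obtain s where s: "(\<lambda>n. f (real n)) sums s" by blast
  then have "sum_integral_diff_series \<longlonglongrightarrow> s - 1 / (2 * sqrt t)"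
    unfolding sum_integral_diff_series_def[abs_def] sums_def_le
    by (intro tendsto_diff lim)
  moreover have "sum_integral_diff_series n \<le> 1" for n
  proof -
    have "sum_integral_diff_series 0 = 1"
      unfolding sum_integral_diff_series_def by (simp add: f_def)
    then show ?thesis using sum_integral_diff_series_antimono[of 0 n] by linarith
  qed
  ultimately have "0 \<le> s - 1 / (2 * sqrt t)" "s - 1 / (2 * sqrt t) \<le> 1"
    using sum_integral_diff_series_nonneg by (blast intro: LIMSEQ_le_const LIMSEQ_le_const2)+
  moreover have "((\<lambda>n. exp (- (pi * t * (real_of_int n)\<^sup>2))) has_sum (2 * s - 1)) UNIV"
    using has_sum_even_int[of "\<lambda>n. exp (- (pi * t * (real_of_int n)\<^sup>2))" s] s by (simp add: f_def)
  then have "theta 0 t = 2 * s - 1"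
    using has_sum_unique[OF has_sum_theta[OF t, of 0]] by simp
  moreover have "1 / sqrt t = 2 * (1 / (2 * sqrt t))" by simp
  ultimately show ?thesis by linarith
qed

text \<open>Multiplying the previous bound by \<open>sqrt (T n)\<close> leaves an error of at most
  \<open>sqrt (T n)\<close>, so this leading behaviour needs no Poisson summation.\<close>

lemma tendsto_theta_zero_cusp:
  assumes T: "\<And>n. T n > 0" and "T \<longlonglongrightarrow> 0"
  shows "(\<lambda>n. T n * (theta 0 (T n))\<^sup>2) \<longlonglongrightarrow> 1"
proof -
  have le: "norm (sqrt (T n) * theta 0 (T n) - 1) \<le> sqrt (T n)" for n
  proof -
    have "sqrt (T n) * \<bar>theta 0 (T n) - 1 / sqrt (T n)\<bar> \<le> sqrt (T n) * 1"
      using T[of n] by (intro mult_left_mono theta_zero_bounds) simp_all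
    moreover have "sqrt (T n) * \<bar>theta 0 (T n) - 1 / sqrt (T n)\<bar> = \<bar>sqrt (T n) * (theta 0 (T n) - 1 / sqrt (T n))\<bar>"
      using T[of n] by (simp add: abs_mult)
    moreover have "sqrt (T n) * (theta 0 (T n) - 1 / sqrt (T n)) = sqrt (T n) * theta 0 (T n) - 1"
      using T[of n] by (simp add: right_diff_distrib)
    ultimately show ?thesis by simp
  qed
  have "(\<lambda>n. sqrt (T n)) \<longlonglongrightarrow> 0"
    using tendsto_real_sqrt[OF assms(2)] by simp
  then have "(\<lambda>n. sqrt (T n) * theta 0 (T n) - 1) \<longlonglongrightarrow> 0"
    by (rule Lim_null_comparison[OF always_eventually[OF allI[OF le]]])
  then have "(\<lambda>n. sqrt (T n) * theta 0 (T n)) \<longlonglongrightarrow> 1"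
    by (rule LIM_zero_cancel)
  then have "(\<lambda>n. (sqrt (T n) * theta 0 (T n))\<^sup>2) \<longlonglongrightarrow> 1\<^sup>2"
    by (rule tendsto_power)
  moreover have "(sqrt (T n) * theta 0 (T n))\<^sup>2 = T n * (theta 0 (T n))\<^sup>2" for n
    using T[of n] by (simp add: power_mult_distrib)
  ultimately show ?thesis by simp
qed

text \<open>Both \<open>(theta 0, theta_alt)\<close> along \<open>t = 2\<^sup>n\<close> and \<open>(theta 0, theta (1/2))\<close> along
  \<open>t = 2\<^sup>-\<^sup>n\<close>, squared and suitably scaled, are arithmetic-geometric mean iterations
  with limit 1, and they have the same first component at \<open>n = 0\<close>.\<close>

lemma theta_alt_eq_theta_half: "(theta_alt 1)\<^sup>2 = (theta (1/2) 1)\<^sup>2"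
proof -
  define a where "a = (\<lambda>n::nat. (theta 0 (2 ^ n))\<^sup>2)"
  define b where "b = (\<lambda>n::nat. (theta_alt (2 ^ n))\<^sup>2)"
  \<comment> \<open>The factor \<open>(1/2) ^ n\<close> turns duplication, read from
    \<open>t\<close> to \<open>t / 2\<close>, into means, and is exactly the weight for which the
    cusp limit is 1.\<close>
  define a' where "a' = (\<lambda>n::nat. (1/2) ^ n * (theta 0 ((1/2) ^ n))\<^sup>2)"
  define b' where "b' = (\<lambda>n::nat. (1/2) ^ n * (theta (1/2) ((1/2) ^ n))\<^sup>2)"
  have a: "a (Suc n) = (a n + b n) / 2" for n
    using theta_zero_square[of "2 ^ n"] theta_alt_square[of "2 ^ n"] by (simp add: a_def b_def)
  have b: "(b (Suc n))\<^sup>2 = a n * b n" for n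
    using theta_alt_double[of "2 ^ n"] by (simp add: a_def b_def)
  have a': "a' (Suc n) = (a' n + b' n) / 2" for n
    using theta_zero_square[of "(1/2) ^ Suc n"] by (simp add: a'_def b'_def field_simps)
  have b': "(b' (Suc n))\<^sup>2 = a' n * b' n" for n
    using theta_half_square[of "(1/2) ^ Suc n"]
    by (simp add: a'_def b'_def power2_eq_square field_simps)
  have "filterlim (\<lambda>n. 2 ^ n :: real) at_top sequentially"
    by (rule filterlim_at_top_mono[OF filterlim_real_sequentially])
       (intro always_eventually allI less_imp_le of_nat_less_two_power)
  then have "(\<lambda>n. theta 0 (2 ^ n)) \<longlonglongrightarrow> 1"
    by (intro tendsto_thetas_at_top) simp_all
  from tendsto_power[OF this, of 2] have a_lim: "a \<longlonglongrightarrow> 1"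
    by (simp add: a_def)
  have a'_lim: "a' \<longlonglongrightarrow> 1"
    unfolding a'_def by (rule tendsto_theta_zero_cusp) (auto intro: LIMSEQ_realpow_zero)
  have pos: "a n > 0" "a' n > 0" "b n \<ge> 0" "b' n \<ge> 0" for n
    using theta_pos[of "2 ^ n" 0] theta_pos[of "(1/2) ^ n" 0]
    by (simp_all add: a_def a'_def b_def b'_def)
  have init: "a 0 = a' 0" by (simp add: a_def a'_def)
  \<comment> \<open>The comparison is used in both directions.\<close>
  have "b 0 \<le> b' 0"
    using agm_le[of a b a' b', OF a b a' b' pos(2,3,4) a_lim a'_lim init] .
  moreover have "b' 0 \<le> b 0"
    using agm_le[of a' b' a b, OF a' b' a b pos(1,4,3) a'_lim a_lim init[symmetric]] .
  ultimately show ?thesis by (simp add: b_def b'_def)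
qed

subsection \<open>Euler's product\<close>

text \<open>The finite q-Pochhammer symbol \<open>(p; p)_n\<close>.\<close>

definition euler_prod :: "'a::field \<Rightarrow> nat \<Rightarrow> 'a" where
  "euler_prod p n = (\<Prod>k<n. 1 - p ^ Suc k)"

text \<open>Expanding \<open>1 / (exp (pi * r * k) - 1)\<close> as a geometric series gives a
  nonnegative double series; summing it in the other order produces the logarithms of the Euler
  factors.\<close>

lemma tendsto_euler_prod:
  assumes r: "r > 0"
  shows "euler_prod (exp (- (pi * r))) \<longlonglongrightarrow> exp (- S 1 r)"
proof -
  define p where "p = exp (- (pi * r))"
  have p: "0 < p" "p < 1" using r by (simp_all add: p_def)
  have pk: "0 < p ^ Suc k" "p ^ Suc k < 1" for k
    using p by (simp_all add: power_Suc_less_one del: power_Suc)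
  \<comment> \<open>Summing over \<open>m\<close> (rows) gives the terms of \<open>S 1 r\<close>;
    summing over \<open>k\<close> (columns) gives \<open>- ln (1 - p ^ Suc m)\<close>.\<close>
  define F where "F = (\<lambda>(k, m). (p ^ Suc k) ^ Suc m / real (Suc k))"
  define f where "f = (\<lambda>k. 1 / (real (Suc k) ^ 1 * (exp (pi * r * real (Suc k)) - 1)))"
  have F_nonneg: "F x \<ge> 0" for x
    using p by (auto simp: F_def split: prod.split)
  have row: "((\<lambda>m. F (k, m)) has_sum f k) UNIV" for k
  proof (rule sums_nonneg_imp_has_sum)
    define y where "y = p ^ Suc k"
    have y: "0 < y" "y < 1" using pk by (simp_all add: y_def)
    have "(\<lambda>m. y / real (Suc k) * y ^ m) sums (y / real (Suc k) * (1 / (1 - y)))"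
      using y by (intro sums_mult geometric_sums) simp
    moreover have "y = exp (- (pi * r * real (Suc k)))"
      unfolding y_def p_def exp_of_nat_mult[symmetric] by (rule arg_cong[where f = exp]) simp
    then have "exp (pi * r * real (Suc k)) = inverse y"
      by (simp add: exp_minus)
    then have "f k = 1 / (real (Suc k) * (inverse y - 1))"
      by (simp only: f_def power_one_right)
    moreover have "1 / (c * (inverse y - 1)) = y / c * (1 / (1 - y))" if "c > 0" for c
      using y that by (simp add: field_simps)
    ultimately have "(\<lambda>m. y / real (Suc k) * y ^ m) sums f k"
      by (simp only: of_nat_0_less_iff zero_less_Suc)
    then show "(\<lambda>m. F (k, m)) sums f k"
      by (simp add: F_def y_def)
  qed (rule F_nonneg)
  have f_nonneg: "f k \<ge> 0" for k
    using has_sum_nonneg[OF row[of k]] F_nonneg by simp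
  have "f sums S 1 r"
    unfolding S_def f_def using summable_S[OF r, of 1] by (rule summable_sums)
  then have f: "(f has_sum S 1 r) UNIV"
    by (rule sums_nonneg_imp_has_sum) (rule f_nonneg)
  have "(\<lambda>x. norm (F x)) summable_on Sigma UNIV (\<lambda>_. UNIV)"
    using row f infsumI[OF row]
    by (subst Infinite_Sum.abs_summable_on_Sigma_iff)
       (auto simp: F_nonneg f_nonneg intro: has_sum_imp_summable)
  then have "F summable_on UNIV \<times> UNIV"
    by (rule abs_summable_summable)
  then have "(F has_sum S 1 r) (UNIV \<times> UNIV)"
    using row f by (intro has_sum_SigmaI)
  then have pairs: "((\<lambda>(m, k). F (k, m)) has_sum S 1 r) (UNIV \<times> UNIV)"
    by (subst (asm) has_sum_swap)
  have column: "((\<lambda>k. F (k, m)) has_sum - ln (1 - p ^ Suc m)) UNIV" for m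
  proof (rule sums_nonneg_imp_has_sum)
    define y where "y = p ^ Suc m"
    have y: "0 < y" "y < 1" using pk by (simp_all add: y_def)
    have "(\<lambda>n. - (- (y ^ n) / real n)) sums - ln (1 - y)"
      using ln_series'[of "- y"] y by (intro sums_minus) simp
    \<comment> \<open>The term at \<open>n = 0\<close> is a division by zero, hence 0, so the index
      can be shifted.\<close>
    then have "(\<lambda>n. y ^ Suc n / real (Suc n)) sums - ln (1 - y)"
      by (subst sums_Suc_iff) simp
    then show "(\<lambda>k. F (k, m)) sums - ln (1 - p ^ Suc m)"
      unfolding F_def y_def prod.case power_mult[symmetric] mult.commute[of "Suc m"] .
  qed (rule F_nonneg)
  have "((\<lambda>m. - ln (1 - p ^ Suc m)) has_sum S 1 r) UNIV"
    by (rule has_sum_SigmaD[OF pairs]) (simp only: prod.case column)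
  then have "(\<lambda>m. - ln (1 - p ^ Suc m)) sums S 1 r"
    by (rule has_sum_imp_sums)
  then have "(\<lambda>n. exp (- (\<Sum>m<n. - ln (1 - p ^ Suc m)))) \<longlonglongrightarrow> exp (- S 1 r)"
    unfolding sums_def by (intro tendsto_exp tendsto_minus)
  moreover have "exp (- (\<Sum>m<n. - ln (1 - p ^ Suc m))) = euler_prod p n" for n
    using pk by (simp add: euler_prod_def sum_negf exp_sum del: power_Suc)
  ultimately show ?thesis by (simp add: p_def)
qed

text \<open>The partial products decrease to their limit. The positive lower bound later controls
  denominators uniformly in \<open>n\<close>.\<close>

lemma euler_prod_bounds:
  assumes r: "r > 0"
  shows "exp (- S 1 r) \<le> euler_prod (exp (- (pi * r))) n" "euler_prod (exp (- (pi * r))) n \<le> 1"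
proof -
  let ?p = "exp (- (pi * r))"
  have p: "0 \<le> 1 - ?p ^ Suc k" "1 - ?p ^ Suc k \<le> 1" for k
    using r power_le_one[of ?p "Suc k"] by simp_all
  have nonneg: "0 \<le> euler_prod ?p n" for n
    unfolding euler_prod_def by (intro prod_nonneg ballI p)
  have "decseq (euler_prod ?p)"
  proof (rule decseq_SucI)
    fix n
    have "euler_prod ?p (Suc n) = euler_prod ?p n * (1 - ?p ^ Suc n)"
      by (simp add: euler_prod_def)
    also have "\<dots> \<le> euler_prod ?p n * 1"
      by (intro mult_left_mono p nonneg)
    finally show "euler_prod ?p (Suc n) \<le> euler_prod ?p n" by simp
  qed
  then show "exp (- S 1 r) \<le> euler_prod ?p n"
    by (rule decseq_ge) (rule tendsto_euler_prod[OF r])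
  show "euler_prod ?p n \<le> 1"
    unfolding euler_prod_def by (intro prod_le_1 conjI p)
qed

subsection \<open>The finite triple product\<close>

text \<open>The Gaussian binomial coefficient. The value 0 for \<open>j > n\<close> makes the Pascal
  rule hold also at \<open>j = n\<close>.\<close>

definition q_binom :: "'a::field \<Rightarrow> nat \<Rightarrow> nat \<Rightarrow> 'a" where
  "q_binom p n j = (if j \<le> n then euler_prod p n / (euler_prod p j * euler_prod p (n - j)) else 0)"

text \<open>The q-Pascal rule; after clearing denominators it is
  \<open>1 - u * v = (1 - u) + u * (1 - v)\<close> with \<open>u = p ^ (n - j)\<close> and
  \<open>v = p ^ Suc j\<close>.\<close>

lemma q_binom_Suc_Suc:
  fixes p :: "'a::field"
  assumes p: "\<And>k. p ^ Suc k \<noteq> 1" and j: "j \<le> n"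
  shows "q_binom p (Suc n) (Suc j) = q_binom p n (Suc j) + p ^ (n - j) * q_binom p n j"
proof -
  have nz: "euler_prod p m \<noteq> 0" for m
    using p by (simp add: euler_prod_def)
  have E0: "euler_prod p 0 = 1" by (simp add: euler_prod_def)
  have nz1: "1 - p ^ Suc m \<noteq> 0" for m using p[of m] by simp
  have Suc: "euler_prod p (Suc m) = euler_prod p m * (1 - p ^ Suc m)" for m
    by (simp add: euler_prod_def)
  show ?thesis
  proof (cases "j = n")
    case True
    then show ?thesis using nz[of n] nz[of "Suc n"] E0 by (simp add: q_binom_def)
  next
    case False
    then obtain d where d: "n = Suc (j + d)" using j less_iff_Suc_add le_neq_implies_less by blast
    have e: "n - j = Suc d" "Suc n - Suc j = Suc d" "n - Suc j = d" "Suc j \<le> n" using d by simp_all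
    have pw: "p ^ Suc n = p ^ Suc d * p ^ Suc j" by (simp add: d power_add mult_ac)
    define A B C u v where "A = euler_prod p n" "B = euler_prod p j" "C = euler_prod p d"
      "u = p ^ Suc d" "v = p ^ Suc j"
    have nz': "A \<noteq> 0" "B \<noteq> 0" "C \<noteq> 0" "1 - u \<noteq> 0" "1 - v \<noteq> 0"
      unfolding A_B_C_u_v_def using nz nz1 by blast+
    have "A * (1 - u * v) / (B * (1 - v) * (C * (1 - u))) = A / (B * (1 - v) * C) + u * (A / (B * (C * (1 - u))))"
      using nz' by (simp add: divide_simps) (simp add: algebra_simps)
    then show ?thesis
      using j e unfolding q_binom_def by (simp add: Suc pw A_B_C_u_v_def del: power_Suc)
  qed
qed

text \<open>Induction on \<open>n\<close>: the q-Pascal rule splits the sum into the old sum and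
  \<open>x * p ^ n\<close> times the old sum.\<close>

lemma q_binomial_theorem:
  fixes p x :: "'a::field"
  assumes p: "\<And>k. p ^ Suc k \<noteq> 1"
  shows "(\<Prod>k<n. 1 + x * p ^ k) = (\<Sum>j\<le>n. p ^ (j choose 2) * q_binom p n j * x ^ j)"
proof (induction n)
  case 0
  then show ?case by (simp add: q_binom_def euler_prod_def numeral_2_eq_2)
next
  case (Suc n)
  define a where "a = (\<lambda>m j. p ^ (j choose 2) * q_binom p m j * x ^ j)"
  have nz: "euler_prod p m \<noteq> 0" for m
    using p by (simp add: euler_prod_def)
  have b0: "q_binom p m 0 = 1" for m
    using nz[of m] by (simp add: q_binom_def) (simp add: euler_prod_def)
  have step: "a (Suc n) (Suc j) = a n (Suc j) + x * p ^ n * a n j" if "j \<le> n" for j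
  proof -
    have "Suc j choose 2 = (j choose 2) + j"
      by (simp add: numeral_2_eq_2)
    moreover have "p ^ j * p ^ (n - j) = p ^ n"
      using that by (simp flip: power_add)
    ultimately show ?thesis
      unfolding a_def q_binom_Suc_Suc[OF p that]
      by (simp add: power_add algebra_simps)
  qed
  have "(\<Sum>j\<le>Suc n. a (Suc n) j) = a (Suc n) 0 + (\<Sum>j\<le>n. a (Suc n) (Suc j))"
    by (rule sum.atMost_Suc_shift)
  also have "\<dots> = a n 0 + (\<Sum>j\<le>n. a n (Suc j)) + x * p ^ n * (\<Sum>j\<le>n. a n j)"
    by (simp add: step sum.distrib sum_distrib_left) (simp add: a_def b0)
  \<comment> \<open>The extra top term vanishes since
    \<open>q_binom p n (Suc n) = 0\<close>.\<close>
  also have "a n 0 + (\<Sum>j\<le>n. a n (Suc j)) = (\<Sum>j\<le>n. a n j)"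
    unfolding sum.atMost_Suc_shift[symmetric] by (simp add: a_def q_binom_def)
  finally show ?case
    using Suc by (simp add: a_def algebra_simps)
qed

text \<open>A finite form of Jacobi's triple product: the q-binomial theorem with
  \<open>2 * n\<close> factors, recentred at \<open>j = n\<close>. Writing factors as
  \<open>q ^ (2 * i + 1) + z\<close>, with \<open>q = exp (- (pi * t))\<close>, avoids negative
  powers of \<open>z\<close>.\<close>

lemma finite_triple_product:
  fixes t z :: real
  assumes t: "t > 0"
  shows "(\<Sum>j\<le>2 * n. z ^ j * exp (- (pi * t * (real j - real n)\<^sup>2)) * q_binom (exp (- (pi * (2 * t)))) (2 * n) j)
    = (\<Prod>i<n. (exp (- (pi * t * real (2 * i + 1))) + z) * (1 + z * exp (- (pi * t * real (2 * i + 1)))))"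
proof -
  define p where "p = exp (- (pi * (2 * t)))"
  have "p ^ Suc k < 1" for k using t by (intro power_Suc_less_one) (simp_all add: p_def)
  then have p: "p ^ Suc k \<noteq> 1" for k by (simp add: less_le)
  \<comment> \<open>The exponents run symmetrically over the odd numbers from
    \<open>2 * n - 1\<close> down to \<open>1 - 2 * n\<close>, and each induction step adds one at
    either end. As \<open>n\<^sup>2\<close> is the sum of the first \<open>n\<close> odd numbers,
    the Gaussian prefactor absorbs the growing exponentials.\<close>
  have split: "exp (- (pi * t * (real n)\<^sup>2)) * (\<Prod>k<2 * n. 1 + z * exp (pi * t * (2 * real n - 1 - 2 * real k)))
    = (\<Prod>i<n. (exp (- (pi * t * real (2 * i + 1))) + z) * (1 + z * exp (- (pi * t * real (2 * i + 1)))))" for n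
  proof (induction n)
    case (Suc n)
    let ?g = "\<lambda>n k. 1 + z * exp (pi * t * (2 * real n - 1 - 2 * real k))"
    have "(\<Prod>k<2 * Suc n. ?g (Suc n) k) = (\<Prod>k<Suc (Suc (2 * n)). ?g (Suc n) k)"
      by simp
    also have "\<dots> = ?g (Suc n) 0 * (\<Prod>k<2 * n. ?g (Suc n) (Suc k)) * ?g (Suc n) (2 * n + 1)"
      by (subst prod.lessThan_Suc, subst prod.lessThan_Suc_shift) simp
    also have "(\<Prod>k<2 * n. ?g (Suc n) (Suc k)) = (\<Prod>k<2 * n. ?g n k)"
      by (simp add: algebra_simps)
    finally have 1: "(\<Prod>k<2 * Suc n. ?g (Suc n) k) = ?g (Suc n) 0 * (\<Prod>k<2 * n. ?g n k) * ?g (Suc n) (2 * n + 1)" .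
    have 2: "exp (- (pi * t * (real (Suc n))\<^sup>2)) * ?g (Suc n) 0
        = exp (- (pi * t * (real n)\<^sup>2)) * (exp (- (pi * t * real (2 * n + 1))) + z)"
      by (simp add: distrib_left power2_eq_square algebra_simps flip: exp_add)
    have 3: "?g (Suc n) (2 * n + 1) = 1 + z * exp (- (pi * t * real (2 * n + 1)))"
      by (simp add: algebra_simps)
    have "exp (- (pi * t * (real (Suc n))\<^sup>2)) * (\<Prod>k<2 * Suc n. ?g (Suc n) k)
        = (exp (- (pi * t * (real (Suc n))\<^sup>2)) * ?g (Suc n) 0) * (\<Prod>k<2 * n. ?g n k) * ?g (Suc n) (2 * n + 1)"
      unfolding 1 by (simp only: mult.assoc)
    also have "\<dots> = (exp (- (pi * t * (real n)\<^sup>2)) * (\<Prod>k<2 * n. ?g n k))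
        * ((exp (- (pi * t * real (2 * n + 1))) + z) * (1 + z * exp (- (pi * t * real (2 * n + 1)))))"
      unfolding 2 3 by (simp only: mult_ac)
    finally show ?case
      unfolding prod.lessThan_Suc Suc.IH .
  qed simp
  \<comment> \<open>Chosen so that \<open>x * p ^ k\<close> is the \<open>k\<close>-th summand of
    the symmetric product.\<close>
  define x where "x = z * exp (pi * t * (2 * real n - 1))"
  have "(\<Prod>k<2 * n. 1 + z * exp (pi * t * (2 * real n - 1 - 2 * real k))) = (\<Prod>k<2 * n. 1 + x * p ^ k)"
    by (simp add: x_def p_def algebra_simps flip: exp_add exp_of_nat_mult)
  also have "\<dots> = (\<Sum>j\<le>2 * n. p ^ (j choose 2) * q_binom p (2 * n) j * x ^ j)"
    by (rule q_binomial_theorem[OF p])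
  finally have "exp (- (pi * t * (real n)\<^sup>2)) * (\<Prod>k<2 * n. 1 + z * exp (pi * t * (2 * real n - 1 - 2 * real k)))
    = (\<Sum>j\<le>2 * n. exp (- (pi * t * (real n)\<^sup>2)) * (p ^ (j choose 2) * q_binom p (2 * n) j * x ^ j))"
    by (simp only: sum_distrib_left)
  also have "\<dots> = (\<Sum>j\<le>2 * n. z ^ j * exp (- (pi * t * (real j - real n)\<^sup>2)) * q_binom p (2 * n) j)"
  proof (rule sum.cong)
    fix j :: nat
    have ev: "even (j * (j - 1))" by (cases j) auto
    have "2 * (j choose 2) = j * (j - 1)" using ev by (simp add: choose_two)
    then have "real (2 * (j choose 2)) = real (j * (j - 1))" by (rule arg_cong)
    then have ch: "2 * real (j choose 2) = real j * real j - real j"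
      by (cases j) (simp_all add: algebra_simps)
    have 1: "p ^ (j choose 2) = exp (- (pi * t * (2 * real (j choose 2))))"
      by (simp add: p_def mult_ac flip: exp_of_nat_mult)
    have 2: "x ^ j = z ^ j * exp (real j * (pi * t * (2 * real n - 1)))"
      by (simp add: x_def power_mult_distrib flip: exp_of_nat_mult)
    \<comment> \<open>The exponents combine by \<open>n\<^sup>2 + (j\<^sup>2 - j) - j * (2 * n - 1)
      = (j - n)\<^sup>2\<close>.\<close>
    have 3: "exp (- (pi * t * (real n)\<^sup>2)) * exp (- (pi * t * (2 * real (j choose 2)))) * exp (real j * (pi * t * (2 * real n - 1)))
      = exp (- (pi * t * (real j - real n)\<^sup>2))"
      unfolding ch exp_add[symmetric] by (rule arg_cong[where f = exp]) (simp add: algebra_simps power2_eq_square)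
    show "exp (- (pi * t * (real n)\<^sup>2)) * (p ^ (j choose 2) * q_binom p (2 * n) j * x ^ j)
      = z ^ j * exp (- (pi * t * (real j - real n)\<^sup>2)) * q_binom p (2 * n) j"
      unfolding 1 2 3[symmetric] by (simp only: mult_ac)
  qed simp
  finally show ?thesis
    unfolding split by (simp only: p_def)
qed

subsection \<open>Product formulas for the theta constants\<close>

text \<open>Each recentred coefficient tends to the reciprocal of the infinite Euler product, and
  all share one bound, so dominated convergence applies.\<close>

lemma tendsto_q_binom_sum:
  fixes g :: "int \<Rightarrow> real"
  assumes r: "r > 0" and g: "g summable_on UNIV"
  shows "(\<lambda>n. \<Sum>j\<le>2 * n. g (int j - int n) * q_binom (exp (- (pi * r))) (2 * n) j)
    \<longlonglongrightarrow> infsum g UNIV * exp (S 1 r)"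
proof -
  define p where "p = exp (- (pi * r))"
  define E where "E = euler_prod p"
  \<comment> \<open>The coefficient \<open>q_binom p (2 * n) (n + m)\<close>, extended by 0 to all
    integers \<open>m\<close>.\<close>
  define w where "w = (\<lambda>n m. if \<bar>m\<bar> \<le> int n then E (2 * n) / (E (nat (int n + m)) * E (nat (int n - m))) else 0)"
  let ?L = "exp (- S 1 r)"
  have E: "E \<longlonglongrightarrow> ?L" "?L \<le> E n" "E n \<le> 1" for n
    using tendsto_euler_prod[OF r] euler_prod_bounds[OF r] by (simp_all add: E_def p_def)
  have E_pos: "E n > 0" for n
    using E(2)[of n] by (rule order_less_le_trans[OF exp_gt_zero])
  have sum: "(\<Sum>\<^sub>\<infinity>m. g m * w n m) = (\<Sum>j\<le>2 * n. g (int j - int n) * q_binom p (2 * n) j)" for n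
  proof -
    have "(\<Sum>\<^sub>\<infinity>m. g m * w n m) = (\<Sum>\<^sub>\<infinity>m\<in>{- int n..int n}. g m * w n m)"
      by (rule infsum_cong_neutral) (auto simp: w_def)
    also have "\<dots> = (\<Sum>m\<in>{- int n..int n}. g m * w n m)"
      by simp
    also have "\<dots> = (\<Sum>j\<le>2 * n. g (int j - int n) * q_binom p (2 * n) j)"
    proof (rule sum.reindex_bij_witness[where i = "\<lambda>j. int j - int n" and j = "\<lambda>m. nat (m + int n)"])
      fix m assume "m \<in> {- int n..int n}"
      moreover from this have "2 * n - nat (m + int n) = nat (int n - m)" by auto
      ultimately show "g (int (nat (m + int n)) - int n) * q_binom p (2 * n) (nat (m + int n)) = g m * w n m"
        by (auto simp: w_def q_binom_def E_def add.commute)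
    qed auto
    finally show ?thesis .
  qed
  have w_lim: "(\<lambda>n. w n m) \<longlonglongrightarrow> exp (S 1 r)" for m
  proof -
    have top: "filterlim (\<lambda>n. nat (int n + k)) at_top sequentially" for k
      unfolding filterlim_at_top
    proof
      fix Z
      show "\<forall>\<^sub>F n in sequentially. Z \<le> nat (int n + k)"
        by (rule eventually_sequentiallyI[of "Z + nat \<bar>k\<bar>"]) auto
    qed
    have "(\<lambda>n. E (2 * n) / (E (nat (int n + m)) * E (nat (int n + - m)))) \<longlonglongrightarrow> ?L / (?L * ?L)"
      by (intro tendsto_divide tendsto_mult filterlim_compose[OF E(1)] top mult_nat_left_at_top) auto
    moreover have "?L / (?L * ?L) = exp (S 1 r)" by (simp flip: exp_add exp_diff)
    moreover have "\<forall>\<^sub>F n in sequentially. E (2 * n) / (E (nat (int n + m)) * E (nat (int n + - m))) = w n m"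
      by (rule eventually_sequentiallyI[of "nat \<bar>m\<bar>"]) (auto simp: w_def)
    ultimately show ?thesis by (auto intro: Lim_transform_eventually)
  qed
  \<comment> \<open>The numerator is at most 1 and both denominator factors are at least
    \<open>?L\<close>.\<close>
  have w_le: "\<bar>w n m\<bar> \<le> 1 / (?L * ?L)" for n m
  proof (cases "\<bar>m\<bar> \<le> int n")
    case True
    have "E (2 * n) / (E (nat (int n + m)) * E (nat (int n - m))) \<le> 1 / (?L * ?L)"
      by (intro frac_le mult_mono E mult_pos_pos less_imp_le[OF E_pos]) auto
    then show ?thesis using True E_pos by (simp add: w_def abs_mult abs_of_pos)
  qed (simp add: w_def)
  have "(\<lambda>n. \<Sum>\<^sub>\<infinity>m. g m * w n m) \<longlonglongrightarrow> (\<Sum>\<^sub>\<infinity>m. g m * exp (S 1 r))"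
  proof (rule tendsto_infsum_dominated)
    show "(\<lambda>m. \<bar>g m\<bar> * (1 / (?L * ?L))) summable_on UNIV"
      using g summable_on_iff_abs_summable_on_real[of g UNIV] by (intro summable_on_cmult_left) simp
    show "\<bar>g m * w n m\<bar> \<le> \<bar>g m\<bar> * (1 / (?L * ?L))" for n m
      unfolding abs_mult by (intro mult_left_mono w_le) simp
    show "(\<lambda>n. g m * w n m) \<longlonglongrightarrow> g m * exp (S 1 r)" for m
      by (intro tendsto_mult_left w_lim)
  qed
  then show ?thesis
    unfolding sum infsum_cmult_left' by (simp only: p_def)
qed

text \<open>Removing the even-indexed factors from Euler's product at \<open>q\<close> divides it by
  Euler's product at \<open>q\<^sup>2\<close>.\<close>

lemma tendsto_odd_prod:
  assumes t: "t > 0"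
  shows "(\<lambda>n. \<Prod>i<n. 1 - exp (- (pi * t)) ^ (2 * i + 1)) \<longlonglongrightarrow> exp (- S 1 t) / exp (- S 1 (2 * t))"
proof -
  define q where "q = exp (- (pi * t))"
  have q2: "exp (- (pi * (2 * t))) = q\<^sup>2"
    by (simp add: q_def flip: exp_of_nat_mult)
  have eq: "(\<Prod>i<n. 1 - q ^ (2 * i + 1)) * euler_prod (q\<^sup>2) n = euler_prod q (2 * n)" for n
  proof (induction n)
    case (Suc n)
    have "(q\<^sup>2) ^ Suc n = q ^ Suc (2 * n + 1)" by (subst power_mult[symmetric]) simp
    moreover have "euler_prod q (2 * Suc n) = euler_prod q (2 * n) * (1 - q ^ (2 * n + 1)) * (1 - q ^ Suc (2 * n + 1))"
      by (simp add: euler_prod_def)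
    moreover have "euler_prod (q\<^sup>2) (Suc n) = euler_prod (q\<^sup>2) n * (1 - (q\<^sup>2) ^ Suc n)"
      by (simp add: euler_prod_def)
    ultimately show ?case
      unfolding prod.lessThan_Suc Suc.IH[symmetric] by (simp only: mult_ac)
  qed (simp add: euler_prod_def)
  have nz: "euler_prod (q\<^sup>2) n \<noteq> 0" for n
    using euler_prod_bounds(1)[of "2 * t" n] t exp_gt_zero[of "- S 1 (2 * t)"] unfolding q2 by linarith
  have "(\<Prod>i<n. 1 - q ^ (2 * i + 1)) = euler_prod q (2 * n) / euler_prod (q\<^sup>2) n" for n
    by (rule nonzero_eq_divide_eq[THEN iffD2, OF nz eq])
  moreover have "(\<lambda>n. euler_prod q (2 * n) / euler_prod (q\<^sup>2) n) \<longlonglongrightarrow> exp (- S 1 t) / exp (- S 1 (2 * t))"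
    using filterlim_compose[OF tendsto_euler_prod[OF t] mult_nat_left_at_top[of 2]]
      tendsto_euler_prod[of "2 * t"] t unfolding q2 q_def[symmetric]
    by (intro tendsto_divide) simp_all
  ultimately show ?thesis by (simp only: q_def)
qed

text \<open>Each factor is a quotient:
  \<open>(1 + q ^ k) * (1 - q ^ k) = 1 - (q\<^sup>2) ^ k\<close>.\<close>

lemma tendsto_even_prod:
  assumes t: "t > 0"
  shows "(\<lambda>n. \<Prod>i<n. 1 + exp (- (pi * t)) ^ Suc i) \<longlonglongrightarrow> exp (- S 1 (2 * t)) / exp (- S 1 t)"
proof -
  define q where "q = exp (- (pi * t))"
  have q2: "exp (- (pi * (2 * t))) = q\<^sup>2"
    by (simp add: q_def flip: exp_of_nat_mult)
  have "(1 + q ^ Suc n) * (1 - q ^ Suc n) = 1 - (q\<^sup>2) ^ Suc n" for n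
    by (simp add: algebra_simps power2_eq_square power_mult_distrib)
  then have eq: "(\<Prod>i<n. 1 + q ^ Suc i) * euler_prod q n = euler_prod (q\<^sup>2) n" for n
    unfolding euler_prod_def prod.distrib[symmetric] by simp
  have nz: "euler_prod q n \<noteq> 0" for n
    using euler_prod_bounds(1)[OF t, of n] exp_gt_zero[of "- S 1 t"] unfolding q_def by linarith
  have "(\<Prod>i<n. 1 + q ^ Suc i) = euler_prod (q\<^sup>2) n / euler_prod q n" for n
    by (rule nonzero_eq_divide_eq[THEN iffD2, OF nz eq])
  moreover have "(\<lambda>n. euler_prod (q\<^sup>2) n / euler_prod q n) \<longlonglongrightarrow> exp (- S 1 (2 * t)) / exp (- S 1 t)"
    using tendsto_euler_prod[of "2 * t"] tendsto_euler_prod[OF t] t unfolding q2 q_def[symmetric]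
    by (intro tendsto_divide) auto
  ultimately show ?thesis by (simp only: q_def)
qed

text \<open>The triple product at \<open>z = - 1\<close>: the paired factors become negative
  squares, whose \<open>n\<close> signs cancel the sign \<open>(- 1) ^ n\<close> from
  recentring.\<close>

lemma theta_alt_product:
  assumes t: "t > 0"
  shows "theta_alt t = exp (S 1 (2 * t) - 2 * S 1 t)"
proof -
  define q where "q = exp (- (pi * t))"
  define g where "g = (\<lambda>m::int. (if even m then 1 else - 1) * exp (- (pi * t * (of_int m)\<^sup>2)))"
  have g: "g summable_on UNIV" "infsum g UNIV = theta_alt t"
    using has_sum_theta_alt[OF t] by (simp_all add: g_def has_sum_iff)
  have q_pow: "exp (- (pi * t * real k)) = q ^ k" for k
    by (simp add: q_def mult_ac flip: exp_of_nat_mult)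
  have "(\<Sum>j\<le>2 * n. g (int j - int n) * q_binom (exp (- (pi * (2 * t)))) (2 * n) j)
      = (\<Prod>i<n. 1 - q ^ (2 * i + 1))\<^sup>2" for n
  proof -
    have sgn: "(if even (int j - int n) then 1 else - 1) = (- 1 :: real) ^ n * (- 1) ^ j" for j
      by (auto simp: minus_one_power_iff)
    have "(\<Sum>j\<le>2 * n. g (int j - int n) * q_binom (exp (- (pi * (2 * t)))) (2 * n) j)
        = (- 1) ^ n * (\<Sum>j\<le>2 * n. (- 1) ^ j * exp (- (pi * t * (real j - real n)\<^sup>2))
            * q_binom (exp (- (pi * (2 * t)))) (2 * n) j)"
      by (simp only: g_def sgn sum_distrib_left mult.assoc of_int_diff of_int_of_nat_eq)
    also have "\<dots> = (- 1) ^ n * (\<Prod>i<n. - ((1 - q ^ (2 * i + 1))\<^sup>2))"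
      unfolding finite_triple_product[OF t] q_pow by (simp add: power2_eq_square algebra_simps)
    also have "\<dots> = (\<Prod>i<n. 1 - q ^ (2 * i + 1))\<^sup>2"
      by (simp add: prod_uminus prod_power_distrib flip: power_add mult.assoc)
    finally show ?thesis .
  qed
  then have "(\<lambda>n. (\<Prod>i<n. 1 - q ^ (2 * i + 1))\<^sup>2) \<longlonglongrightarrow> theta_alt t * exp (S 1 (2 * t))"
    using tendsto_q_binom_sum[of "2 * t", OF _ g(1)] t g(2) by simp
  moreover have "(\<lambda>n. (\<Prod>i<n. 1 - q ^ (2 * i + 1))\<^sup>2) \<longlonglongrightarrow> (exp (- S 1 t) / exp (- S 1 (2 * t)))\<^sup>2"
    using tendsto_odd_prod[OF t] unfolding q_def by (intro tendsto_power)
  ultimately have "theta_alt t * exp (S 1 (2 * t)) = (exp (- S 1 t) / exp (- S 1 (2 * t)))\<^sup>2"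
    by (rule LIMSEQ_unique)
  then have "theta_alt t * exp (S 1 (2 * t)) = exp (S 1 (2 * t) - 2 * S 1 t) * exp (S 1 (2 * t))"
    by (simp add: power2_eq_square flip: exp_add exp_diff)
  then show ?thesis by simp
qed

text \<open>The triple product at \<open>z = q\<close>: the power \<open>q ^ j\<close> shifts the
  centre of the Gaussian by one half, at the price of \<open>exp (- (pi * t / 4))\<close>.\<close>

lemma theta_half_product:
  assumes t: "t > 0"
  shows "theta (1/2) t = 2 * exp (S 1 (2 * t) - 2 * S 1 (4 * t) - pi * t / 4)"
proof -
  define q where "q = exp (- (pi * t))"
  define h where "h = (\<lambda>m::int. exp (- (pi * t * (of_int m + 1/2)\<^sup>2)))"
  have h: "h summable_on UNIV" "infsum h UNIV = theta (1/2) t"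
    using has_sum_theta[OF t] by (simp_all add: h_def has_sum_iff)
  have q: "0 < q" "q < 1" using t by (simp_all add: q_def)
  have q2: "exp (- (pi * (2 * t))) = q\<^sup>2"
    by (simp add: q_def flip: exp_of_nat_mult)
  have q_pow: "exp (- (pi * t * real k)) = q ^ k" for k
    by (simp add: q_def mult_ac flip: exp_of_nat_mult)
  let ?P = "\<lambda>n. \<Prod>i<n. 1 + (q\<^sup>2) ^ Suc i"
  have main: "(\<Sum>j\<le>2 * n. h (int j - int n) * q_binom (q\<^sup>2) (2 * n) j)
      = exp (- (pi * t / 4)) * (2 * (?P n)\<^sup>2 / (1 + (q\<^sup>2) ^ n))" for n
  proof -
    have "q ^ n * (\<Sum>j\<le>2 * n. h (int j - int n) * q_binom (q\<^sup>2) (2 * n) j)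
        = exp (- (pi * t / 4)) * (\<Sum>j\<le>2 * n. q ^ j * exp (- (pi * t * (real j - real n)\<^sup>2))
            * q_binom (exp (- (pi * (2 * t)))) (2 * n) j)"
      unfolding sum_distrib_left q2
    proof (rule sum.cong)
      fix j
      \<comment> \<open>The exponents agree because
        \<open>n + (j - n + 1/2)\<^sup>2 = 1/4 + j + (j - n)\<^sup>2\<close>.\<close>
      have "q ^ n * h (int j - int n) = exp (- (pi * t / 4)) * (q ^ j * exp (- (pi * t * (real j - real n)\<^sup>2)))"
        unfolding q_pow[symmetric] h_def exp_add[symmetric]
        by (rule arg_cong[where f = exp]) (simp add: field_simps power2_eq_square)
      then show "q ^ n * (h (int j - int n) * q_binom (q\<^sup>2) (2 * n) j)
        = exp (- (pi * t / 4)) * (q ^ j * exp (- (pi * t * (real j - real n)\<^sup>2)) * q_binom (q\<^sup>2) (2 * n) j)"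
        unfolding mult.assoc[symmetric] by simp
    qed simp
    also have "\<dots> = exp (- (pi * t / 4)) * (\<Prod>i<n. (q ^ (2 * i + 1) + q) * (1 + q * q ^ (2 * i + 1)))"
      unfolding finite_triple_product[OF t] q_pow ..
    also have "(\<Prod>i<n. (q ^ (2 * i + 1) + q) * (1 + q * q ^ (2 * i + 1)))
        = (\<Prod>i<n. q * (1 + (q\<^sup>2) ^ i) * (1 + (q\<^sup>2) ^ Suc i))"
      by (rule prod.cong) (simp_all add: power_mult algebra_simps power2_eq_square)
    also have "\<dots> = q ^ n * ((\<Prod>i<n. 1 + (q\<^sup>2) ^ i) * ?P n)"
      by (simp add: prod.distrib)
    \<comment> \<open>Compared with \<open>?P n\<close>, this product has the extra factor 2 at
      \<open>i = 0\<close> and lacks the last factor, which tends to 1.\<close>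
    also have "(\<Prod>i<n. 1 + (q\<^sup>2) ^ i) = 2 * ?P n / (1 + (q\<^sup>2) ^ n)"
    proof -
      have "(\<Prod>i<n. 1 + (q\<^sup>2) ^ i) * (1 + (q\<^sup>2) ^ n) = (\<Prod>i<Suc n. 1 + (q\<^sup>2) ^ i)"
        by simp
      also have "\<dots> = 2 * ?P n"
        by (subst prod.lessThan_Suc_shift) simp
      finally show ?thesis
        using q by (simp add: field_simps add_pos_pos less_imp_neq[symmetric])
    qed
    finally have eq: "q ^ n * (\<Sum>j\<le>2 * n. h (int j - int n) * q_binom (q\<^sup>2) (2 * n) j)
      = q ^ n * (exp (- (pi * t / 4)) * (2 * (?P n)\<^sup>2 / (1 + (q\<^sup>2) ^ n)))"
      by (simp add: power2_eq_square)
    have nz: "q ^ n \<noteq> 0" using q by simp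
    show ?thesis by (rule mult_left_cancel[THEN iffD1, OF nz eq])
  qed
  have "(\<lambda>n. \<Sum>j\<le>2 * n. h (int j - int n) * q_binom (q\<^sup>2) (2 * n) j)
      \<longlonglongrightarrow> theta (1/2) t * exp (S 1 (2 * t))"
    using tendsto_q_binom_sum[of "2 * t", OF _ h(1)] t h(2) by (simp add: q2)
  then have "(\<lambda>n. exp (- (pi * t / 4)) * (2 * (?P n)\<^sup>2 / (1 + (q\<^sup>2) ^ n)))
      \<longlonglongrightarrow> theta (1/2) t * exp (S 1 (2 * t))"
    by (simp only: main)
  moreover have "(\<lambda>n. exp (- (pi * t / 4)) * (2 * (?P n)\<^sup>2 / (1 + (q\<^sup>2) ^ n)))
      \<longlonglongrightarrow> exp (- (pi * t / 4)) * (2 * (exp (- S 1 (4 * t)) / exp (- S 1 (2 * t)))\<^sup>2 / (1 + 0))"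
  proof (intro tendsto_mult_left tendsto_divide tendsto_power tendsto_add tendsto_const)
    show "?P \<longlonglongrightarrow> exp (- S 1 (4 * t)) / exp (- S 1 (2 * t))"
      using tendsto_even_prod[of "2 * t"] t unfolding q2 by simp
    show "(\<lambda>n. (q\<^sup>2) ^ n) \<longlonglongrightarrow> 0"
      using q by (intro LIMSEQ_realpow_zero power2_less_1_iff[THEN iffD2]) auto
  qed simp
  ultimately have "theta (1/2) t * exp (S 1 (2 * t))
      = exp (- (pi * t / 4)) * (2 * (exp (- S 1 (4 * t)) / exp (- S 1 (2 * t)))\<^sup>2 / (1 + 0))"
    by (rule LIMSEQ_unique)
  also have "\<dots> = 2 * exp (S 1 (2 * t) - 2 * S 1 (4 * t) - pi * t / 4) * exp (S 1 (2 * t))"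
    by (simp add: power2_eq_square algebra_simps flip: exp_add exp_diff)
  finally show ?thesis by simp
qed

section \<open>Elimination of \<open>ln 2\<close> from the two logarithmic relations\<close>

theorem mainTheorem5:
  shows "pi = 72 * S 1 1 - 96 * S 1 2 + 24 * S 1 4"
proof -
  have alt: "theta_alt 1 = exp (S 1 2 - 2 * S 1 1)" "theta_alt 2 = exp (S 1 4 - 2 * S 1 2)"
    using theta_alt_product[of 1] theta_alt_product[of 2] by simp_all
  have half: "theta (1/2) 1 = 2 * exp (S 1 2 - 2 * S 1 4 - pi / 4)"
    using theta_half_product[of 1] by simp
  \<comment> \<open>The product formulas show both sides positive, so the squares determine
    them.\<close>
  have "theta_alt 1 = theta (1/2) 1"
    by (rule power2_eq_imp_eq[OF theta_alt_eq_theta_half]) (simp_all add: alt half)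
  then have "ln (theta_alt 1) = ln (theta (1/2) 1)" by simp
  then have 1: "S 1 2 - 2 * S 1 1 = ln 2 + (S 1 2 - 2 * S 1 4 - pi / 4)"
    unfolding alt half by (simp add: ln_mult)
  have "theta 0 1 ^ 4 = 2 * theta_alt 1 ^ 4"
    using jacobi_quartic[of 1] \<open>theta_alt 1 = theta (1/2) 1\<close> by simp
  \<comment> \<open>Squaring the duplication formula produces the fourth power of
    \<open>theta 0 1\<close>, which the quartic identity replaces by
    \<open>2 * theta_alt 1 ^ 4\<close>.\<close>
  moreover have "theta_alt 2 ^ 8 = theta 0 1 ^ 4 * theta_alt 1 ^ 4"
  proof -
    have "theta_alt 2 ^ 8 = (theta_alt 2 ^ 4)\<^sup>2" by simp
    also have "theta_alt 2 ^ 4 = (theta 0 1)\<^sup>2 * (theta_alt 1)\<^sup>2"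
      using theta_alt_double[of 1] by simp
    finally show ?thesis by (simp add: power_mult_distrib)
  qed
  ultimately have "theta_alt 2 ^ 8 = 2 * theta_alt 1 ^ 8"
    by (simp flip: power_add)
  then have "ln (theta_alt 2 ^ 8) = ln (2 * theta_alt 1 ^ 8)" by simp
  then have 2: "8 * (S 1 4 - 2 * S 1 2) = ln 2 + 8 * (S 1 2 - 2 * S 1 1)"
    unfolding alt by (simp add: ln_mult ln_realpow)
  \<comment> \<open>Solved for \<open>l\<close>, the relations read
    \<open>l = 2 * d - 2 * a + p / 4\<close> and \<open>l = 16 * a - 24 * b + 8 * d\<close>;
    equating them and multiplying by 4 gives the coefficients.\<close>
  have "p = 72 * a - 96 * b + 24 * d"
    if "b - 2 * a = l + (b - 2 * d - p / 4)" "8 * (d - 2 * b) = l + 8 * (b - 2 * a)" for a b d l p :: real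
    using that by (simp add: field_simps)
  from this[OF 1 2] show ?thesis .
qed

end
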